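(* Let $R$ be a PID containing $\mathbb{Q}$ with field of fractions $K$, and let $B:=R[X,Y,Z]$ be the polynomial ring in three variables over $R$. Let $D$ be a locally nilpotent $R$-derivation of $B$ such that $D$ is irreducible and $D^{2}X=D^{2}Y=0$. Let $\overline{D}$ denote the extension of $D$ to a locally nilpotent derivation of $K[X,Y,Z]$, and let $A:=\operatorname{Ker} D$. Suppose that there exists a coordinate system $(\overline{L_1},\overline{L_2},Z)$ of $K[X,Y,Z]$, where $\overline{L_1}$ and $\overline{L_2}$ are linear forms in $X$ and $Y$ (with coefficients in $K$), such that $\overline{D}\,\overline{L_1}=0$, $\overline{D}\,\overline{L_2}\in K[\overline{L_1}]$ and $\overline{D}Z\in K[\overline{L_1},\overline{L_2}]=K[X,Y]$. Then the following hold: (i) $\operatorname{rank} D<3$. (ii) There exists a coordinate system $(L_1,L_2,Z)$ of $B$ such that $L_1,L_2$ are linear forms in $X$ and $Y$ (with coefficients in $R$), $DL_1=0$, $DL_2\in R[L_1]$ and $DZ\in R[L_1,L_2]=R[X,Y]$. Moreover, $A=R[L_1,\,bZ+f(L_2)]$, where $b\in R[L_1]$ and $f(L_2)\in R[L_1,L_2]$.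
   Context: A coordinate system of a polynomial ring $B=R^{[n]}$ in $n$ variables over $R$ is an $n$-tuple $(T_1,\dots,T_n)$ of elements of $B$ with $B=R[T_1,\dots,T_n]$. An $R$-derivation $D$ of $B$ is locally nilpotent if for each $b\in B$ there is $n$ with $D^n b=0$. $D$ is reducible if there is a non-unit $b\in B$ with $DB\subseteq bB$, and irreducible otherwise. For a locally nilpotent $R$-derivation $D$ of $B=R^{[n]}$ with kernel $A$, $\operatorname{rank} D$ is the least integer $i$ for which there is a coordinate system $(X_1,\dots,X_n)$ of $B$ with $R[X_{i+1},\dots,X_n]\subseteq A$. In (ii), $f(L_2)$ denotes a polynomial in $L_2$ with coefficients in $R[L_1]$. *)

theory Defs
  imports "HOL-Computational_Algebra.Polynomial_Factorial"
begin

section \<open>Hypotheses on the base ring\<close>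

definition ring_ideal :: "'a::comm_ring_1 set \<Rightarrow> bool" where
  "ring_ideal I \<longleftrightarrow>
     0 \<in> I \<and> (\<forall>x\<in>I. \<forall>y\<in>I. x + y \<in> I) \<and> (\<forall>r. \<forall>x\<in>I. r * x \<in> I)"

text \<open>The \<open>itself\<close> argument names the ring.  As usual, fields count as principal ideal domains.\<close>

definition is_PID :: "'a::idom itself \<Rightarrow> bool" where
  "is_PID _ \<longleftrightarrow> (\<forall>I :: 'a set. ring_ideal I \<longrightarrow> (\<exists>a. I = {r * a | r. True}))"

definition contains_rationals :: "'a::comm_ring_1 itself \<Rightarrow> bool" where
  "contains_rationals _ \<longleftrightarrow>
     (\<exists>h :: rat \<Rightarrow> 'a. inj h \<and> h 1 = 1 \<and>
        (\<forall>x y. h (x + y) = h x + h y) \<and> (\<forall>x y. h (x * y) = h x * h y))"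

section \<open>Algebras, coordinate systems and derivations\<close>

text \<open>
  Throughout, an algebra over a ring is given by its structure map \<open>c\<close>, which is meant to be a
  ring homomorphism; subalgebras are then closed under negation because they contain \<open>c (- 1)\<close>.
\<close>

definition subalgebra :: "('a \<Rightarrow> 'b::comm_ring_1) \<Rightarrow> 'b set \<Rightarrow> bool" where
  "subalgebra c S \<longleftrightarrow>
     range c \<subseteq> S \<and> (\<forall>x\<in>S. \<forall>y\<in>S. x + y \<in> S) \<and> (\<forall>x\<in>S. \<forall>y\<in>S. x * y \<in> S)"

text \<open>\<open>adjoin c {T\<^sub>1, \<dots>, T\<^sub>m}\<close> is \<open>R[T\<^sub>1, \<dots>, T\<^sub>m]\<close>.\<close>

definition adjoin :: "('a \<Rightarrow> 'b::comm_ring_1) \<Rightarrow> 'b set \<Rightarrow> 'b set" where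
  "adjoin c T = subalgebra c hull T"

text \<open>
  In the next definition and in \<open>der_rank\<close>, the algebra is meant to be a polynomial ring in
  exactly \<open>n\<close> variables over the base ring.
\<close>

definition coordinate_system :: "('a \<Rightarrow> 'b::comm_ring_1) \<Rightarrow> nat \<Rightarrow> 'b list \<Rightarrow> bool" where
  "coordinate_system c n Ts \<longleftrightarrow> length Ts = n \<and> adjoin c (set Ts) = UNIV"

definition derivation :: "('a \<Rightarrow> 'b::comm_ring_1) \<Rightarrow> ('b \<Rightarrow> 'b) \<Rightarrow> bool" where
  "derivation c D \<longleftrightarrow>
     (\<forall>f g. D (f + g) = D f + D g) \<and> (\<forall>f g. D (f * g) = f * D g + g * D f) \<and>
     (\<forall>r. D (c r) = 0)"

definition locally_nilpotent :: "('b::zero \<Rightarrow> 'b) \<Rightarrow> bool" where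
  "locally_nilpotent D \<longleftrightarrow> (\<forall>b. \<exists>n. (D ^^ n) b = 0)"

definition reducible_der :: "('b::comm_ring_1 \<Rightarrow> 'b) \<Rightarrow> bool" where
  "reducible_der D \<longleftrightarrow> (\<exists>b. \<not> b dvd 1 \<and> range D \<subseteq> {b * x | x. True})"

definition kernel :: "('b \<Rightarrow> 'b::zero) \<Rightarrow> 'b set" where
  "kernel D = {b. D b = 0}"

text \<open>\<open>drop i [X\<^sub>1, \<dots>, X\<^sub>n]\<close> is \<open>[X\<^sub>i\<^sub>+\<^sub>1, \<dots>, X\<^sub>n]\<close>; the candidate \<open>i = n\<close> always qualifies.\<close>

definition der_rank :: "('a \<Rightarrow> 'b::comm_ring_1) \<Rightarrow> nat \<Rightarrow> ('b \<Rightarrow> 'b) \<Rightarrow> nat" where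
  "der_rank c n D =
     (LEAST i. i \<le> n \<and>
        (\<exists>Xs. coordinate_system c n Xs \<and> adjoin c (set (drop i Xs)) \<subseteq> kernel D))"

section \<open>The polynomial ring in three variables\<close>

text \<open>\<open>R[X,Y,Z]\<close> is realised as \<open>R[X][Y][Z]\<close>.\<close>

type_synonym 'a poly3 = "'a poly poly poly"

definition const3 :: "'a::comm_ring_1 \<Rightarrow> 'a poly3" where
  "const3 r = [:[:[:r:]:]:]"

definition varX :: "'a::comm_ring_1 poly3" where
  "varX = [:[:[:0, 1:]:]:]"

definition varY :: "'a::comm_ring_1 poly3" where
  "varY = [:[:0, 1:]:]"

definition varZ :: "'a::comm_ring_1 poly3" where
  "varZ = [:0, 1:]"

definition linear_form_XY :: "'a::comm_ring_1 poly3 \<Rightarrow> bool" where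
  "linear_form_XY L \<longleftrightarrow> (\<exists>a b. L = const3 a * varX + const3 b * varY)"

text \<open>The inclusion of \<open>R[X,Y,Z]\<close> into \<open>K[X,Y,Z]\<close>, with \<open>K\<close> the field of fractions of \<open>R\<close>.\<close>

definition to_fract3 :: "'a::idom poly3 \<Rightarrow> 'a fract poly3" where
  "to_fract3 = map_poly (map_poly (map_poly to_fract))"

end

theory Submission
  imports Defs
begin

text \<open>
  Over \<open>K\<close>, the form \<open>L1'\<close> is a scalar multiple of a primitive form \<open>L1 = a X + b Y\<close> over \<open>R\<close>, and
  Bezout's identity completes \<open>(a, b)\<close> to a matrix of determinant \<open>1\<close>, whose second row is the form
  \<open>L2\<close>.  So \<open>(L1, L2, Z)\<close> is a coordinate system over \<open>R\<close>.  As \<open>L2\<close> is a \<open>K\<close>-linear combination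
  of \<open>L1'\<close> and \<open>L2'\<close>, the hypotheses over \<open>K\<close> give \<open>D L1 = 0\<close>, \<open>D L2 \<in> K[L1]\<close> and
  \<open>D Z \<in> K[L1, L2]\<close>.  The values of \<open>D\<close> lie in \<open>R[X, Y, Z]\<close>, hence in \<open>R[L1]\<close> and \<open>R[L1, L2]\<close>
  (\<open>to_fract3_adjoin_X_descends\<close>, \<open>to_fract3_adjoin_XY_descends\<close>).  The rank is below three because
  the coordinate \<open>L1\<close> lies in the kernel.

  After the change of coordinates, \<open>D = p(X) \<partial>/\<partial>Y + q(X, Y) \<partial>/\<partial>Z\<close>, and irreducibility says that
  \<open>p\<close> and \<open>q\<close> have no common factor.  If \<open>p = 0\<close>, the kernel is \<open>R[X, Y]\<close>.  Otherwise \<open>q\<close> has an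
  antiderivative \<open>P\<close> with respect to \<open>Y\<close>, since \<open>R\<close> contains the rationals, and \<open>w = p Z - P\<close> is in
  the kernel.  That \<open>X\<close> and \<open>w\<close> generate the kernel is a divisibility statement: the coefficient of
  \<open>Z\<^sup>n\<close> in a kernel element of degree \<open>n\<close> must be a multiple of \<open>p\<^sup>n\<close> (\<open>power_p_dvd_coeff_kernel\<close>),
  so that a multiple of \<open>w\<^sup>n\<close> cancels it (\<open>kernel_if_p_nonzero\<close>).

  The divisibility uses that \<open>p\<close> divides \<open>x\<close> if it divides \<open>q x\<close>.  This is where the base ring
  enters: \<open>R[X]\<close> has unique factorisation because \<open>R\<close> is a principal ideal domain
  (\<open>PID_poly_prime_product\<close>, by Gauss's lemma), and its primes stay prime in \<open>R[X][Y]\<close>.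
\<close>

section \<open>Factorisation into primes over a principal ideal domain\<close>

text \<open>
  An element is a \<open>prime_product\<close> if it is a unit times finitely many primes.  Unique
  factorisation is needed here for a ring that is only assumed to satisfy a predicate, so it is
  expressed by this predicate on elements and not by a type class.\<close>

inductive prime_product :: "'a::comm_semiring_1 \<Rightarrow> bool" where
  unit: "u dvd 1 \<Longrightarrow> prime_product u"
| prime: "prime_elem \<pi> \<Longrightarrow> prime_product x \<Longrightarrow> prime_product (\<pi> * x)"

lemma prime_product_mult:
  assumes "prime_product x" "prime_product y"
  shows "prime_product (x * y)"
  using assms
proof (induction rule: prime_product.induct)
  case (unit u)
  show ?case using unit(2,1)
  proof (induction rule: prime_product.induct)
    case (unit v)
    then show ?case using mult_dvd_mono[of u 1 v 1] by (auto intro: prime_product.unit)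
  next
    case (prime \<pi> x)
    then show ?case using prime_product.prime[of \<pi> "u * x"] by (simp add: mult.left_commute)
  qed
next
  case (prime \<pi> x)
  then show ?case using prime_product.prime[of \<pi> "x * y"] by (simp add: mult.assoc)
qed

definition proper_divisors :: "('a::comm_semiring_1 \<times> 'a) set" where
  "proper_divisors = {(a, b). b \<noteq> 0 \<and> a dvd b \<and> \<not> b dvd a}"

lemma proper_divisor_cofactor_nonunit:
  assumes "\<not> b dvd (1::'a::idom)" "a * b \<noteq> 0"
  shows "(a, a * b) \<in> proper_divisors"
  using assms by (auto simp: proper_divisors_def)

text \<open>
  The usual criterion for unique factorisation: well-foundedness of proper divisibility splits an
  element into irreducibles, and these are prime by assumption.\<close>

lemma prime_product_if_irreducibles_prime:
  assumes wf: "wf (proper_divisors :: ('a::idom \<times> 'a) set)"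
    and irr: "\<And>p::'a. irreducible p \<Longrightarrow> prime_elem p"
    and "x \<noteq> 0"
  shows "prime_product (x::'a)"
  using wf \<open>x \<noteq> 0\<close>
proof (induction x rule: wf_induct_rule)
  case (less x)
  consider "x dvd 1" | "irreducible x" | a b where "x = a * b" "\<not> a dvd 1" "\<not> b dvd 1"
    using less.prems by (auto simp: irreducible_def)
  then show ?case
  proof cases
    case 1
    then show ?thesis by (rule prime_product.unit)
  next
    case 2
    then show ?thesis using prime_product.prime[OF irr prime_product.unit[of 1]] by simp
  next
    case 3
    have "prime_product a" "prime_product b"
      using less proper_divisor_cofactor_nonunit[of b a] proper_divisor_cofactor_nonunit[of a b] 3
      by (auto simp: mult.commute)
    then show ?thesis using 3 prime_product_mult by blast
  qed
qed

text \<open>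
  Along an infinite chain of proper divisors the principal ideals increase strictly.  A generator
  of their union lies in one of them already, which is absurd.\<close>

lemma PID_proper_divisors_wf:
  assumes "is_PID TYPE('a::idom)"
  shows "wf (proper_divisors :: ('a \<times> 'a) set)"
  unfolding wf_iff_no_infinite_down_chain
proof
  assume "\<exists>f. \<forall>i. (f (Suc i), f i) \<in> (proper_divisors :: ('a \<times> 'a) set)"
  then obtain f :: "nat \<Rightarrow> 'a" where f: "\<And>i. f (Suc i) dvd f i" "\<And>i. \<not> f i dvd f (Suc i)"
    unfolding proper_divisors_def by blast
  have mono: "f j dvd f i" if "i \<le> j" for i j
    using that by (induction j rule: dec_induct) (auto intro: dvd_trans f)
  define I where "I = {x. \<exists>i. f i dvd x}"
  have "ring_ideal I" unfolding ring_ideal_def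
  proof (intro conjI ballI allI)
    show "0 \<in> I" by (simp add: I_def)
    fix x assume "x \<in> I"
    then show "r * x \<in> I" for r by (auto simp: I_def intro: dvd_mult)
    fix y assume "y \<in> I"
    with \<open>x \<in> I\<close> obtain i j where "f i dvd x" "f j dvd y" by (auto simp: I_def)
    then have "f (max i j) dvd x" "f (max i j) dvd y"
      by (meson dvd_trans max.cobounded1 max.cobounded2 mono)+
    then show "x + y \<in> I" using dvd_add unfolding I_def by blast
  qed
  then obtain a where a: "I = {r * a | r. True}" using assms unfolding is_PID_def by blast
  then have "a \<in> I" by (metis (mono_tags, lifting) mem_Collect_eq mult_1)
  then obtain n where n: "f n dvd a" by (auto simp: I_def)
  have "f (Suc n) \<in> I" using dvd_refl unfolding I_def by blast
  then have "a dvd f (Suc n)" unfolding a by auto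
  with n f(2) show False using dvd_trans by blast
qed

lemma PID_bezout:
  assumes "is_PID TYPE('a::idom)"
  obtains d u v where "d dvd a" "d dvd b" "d = u * a + v * (b::'a)"
proof -
  define I where "I = {u * a + v * b | u v. True}"
  have "ring_ideal I" unfolding ring_ideal_def
  proof (intro conjI ballI allI)
    show "0 \<in> I" unfolding I_def by (auto intro!: exI[of _ 0])
    fix x assume "x \<in> I"
    then obtain u v where x: "x = u * a + v * b" by (auto simp: I_def)
    show "r * x \<in> I" for r unfolding I_def x
      by (rule CollectI, rule exI[of _ "r * u"], rule exI[of _ "r * v"]) (simp add: algebra_simps)
    fix y assume "y \<in> I"
    then obtain u' v' where y: "y = u' * a + v' * b" by (auto simp: I_def)
    show "x + y \<in> I" unfolding I_def x y
      by (rule CollectI, rule exI[of _ "u + u'"], rule exI[of _ "v + v'"]) (simp add: algebra_simps)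
  qed
  then obtain d where d: "I = {r * d | r. True}" using assms unfolding is_PID_def by blast
  have "a \<in> I" unfolding I_def by (rule CollectI, rule exI[of _ 1], rule exI[of _ 0]) simp
  moreover have "b \<in> I" unfolding I_def by (rule CollectI, rule exI[of _ 0], rule exI[of _ 1]) simp
  moreover have "d \<in> I" unfolding d by (rule CollectI, rule exI[of _ 1]) simp
  ultimately obtain u v w z where "a = w * d" "b = z * d" "d = u * a + v * b"
    using d unfolding I_def by blast
  then show ?thesis using that[of d u v] by (metis dvd_triv_right)
qed

text \<open>
  Write the greatest common divisor of \<open>p\<close> and \<open>a\<close> as \<open>d = u p + v a\<close>.  Either \<open>d\<close> is a unit and
  multiplying by \<open>b\<close> shows that \<open>p\<close> divides \<open>b\<close>, or \<open>d\<close> is associated to \<open>p\<close> and \<open>p\<close> divides \<open>a\<close>.\<close>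

lemma PID_irreducible_prime:
  assumes "is_PID TYPE('a::idom)" "irreducible (p::'a)"
  shows "prime_elem p"
  unfolding prime_elem_def
proof (intro conjI allI impI)
  show "p \<noteq> 0" "\<not> p dvd 1" using assms(2) by (auto simp: irreducible_def)
  fix a b assume ab: "p dvd a * b"
  obtain d u v where d: "d dvd p" "d dvd a" "d = u * p + v * a" by (rule PID_bezout[OF assms(1)])
  from d(1) obtain e where e: "p = d * e" by blast
  then consider "d dvd 1" | "e dvd 1" using assms(2) unfolding irreducible_def by blast
  then show "p dvd a \<or> p dvd b"
  proof cases
    case 1
    then obtain w where "1 = d * w" by blast
    then have "b = w * (u * p + v * a) * b" using d(3) by (simp add: mult.commute)
    also have "\<dots> = p * (w * u * b) + (a * b) * (w * v)" by (simp add: algebra_simps)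
    also have "p dvd \<dots>" using ab by auto
    finally show ?thesis ..
  next
    case 2
    then have "p dvd d" using e by (metis dvd_def mult.assoc mult.right_neutral)
    then show ?thesis using d(2) dvd_trans by blast
  qed
qed

text \<open>
  A proper divisor of a polynomial has smaller degree, or it has the same degree and its
  leading coefficient is a proper divisor; so the two relations combine lexicographically.\<close>

lemma poly_proper_divisors_wf:
  assumes "wf (proper_divisors :: ('a::idom \<times> 'a) set)"
  shows "wf (proper_divisors :: ('a poly \<times> 'a poly) set)"
proof (rule wf_subset)
  show "wf (inv_image (less_than <*lex*> (proper_divisors :: ('a \<times> 'a) set))
              (\<lambda>f::'a poly. (degree f, lead_coeff f)))"
    using assms by auto
  show "(proper_divisors :: ('a poly \<times> 'a poly) set)
      \<subseteq> inv_image (less_than <*lex*> proper_divisors) (\<lambda>f. (degree f, lead_coeff f))"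
  proof (rule subrelI)
    fix g f :: "'a poly" assume "(g, f) \<in> proper_divisors"
    then obtain h where h: "f = g * h" "f \<noteq> 0" "\<not> f dvd g" by (auto simp: proper_divisors_def)
    then have nz: "g \<noteq> 0" "h \<noteq> 0" by auto
    show "(g, f) \<in> inv_image (less_than <*lex*> proper_divisors) (\<lambda>f. (degree f, lead_coeff f))"
    proof (cases "degree h = 0")
      case True
      then obtain c where c: "h = [:c:]" by (auto elim: degree_eq_zeroE)
      have "\<not> c dvd 1"
      proof
        assume "c dvd 1"
        then have "h dvd 1" by (simp add: c is_unit_const_poly_iff)
        then obtain k where "1 = h * k" by blast
        then have "g = f * k" using h(1) by (simp add: mult.assoc flip: \<open>1 = h * k\<close>)
        then show False using h(3) by simp
      qed
      then have "(lead_coeff g, lead_coeff g * c) \<in> proper_divisors"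
        using nz by (intro proper_divisor_cofactor_nonunit) (auto simp: c)
      moreover have "degree f = degree g" "lead_coeff f = lead_coeff g * c"
        using h nz by (auto simp: c mult.commute)
      ultimately show ?thesis by simp
    next
      case False
      then show ?thesis using h nz by (simp add: degree_mult_eq)
    qed
  qed
qed

text \<open>
  A form of Gauss's lemma.  The hypothesis on \<open>f\<close> says that \<open>f\<close> is primitive.  Each prime factor
  \<open>\<pi>\<close> of \<open>c\<close> stays prime in the polynomial ring and does not divide \<open>f\<close>, so it can be cancelled
  from \<open>g\<close>.\<close>

lemma primitive_dvd_const_mult:
  fixes f g h :: "'a::idom poly"
  assumes "prime_product c" "c \<noteq> 0" "\<And>a. [:a:] dvd f \<Longrightarrow> a dvd 1" "f * g = [:c:] * h"
  shows "f dvd h"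
  using assms(1,2,4)
proof (induction c arbitrary: g h rule: prime_product.induct)
  case (unit u)
  then obtain w where "1 = u * w" by blast
  then have "h = [:w:] * ([:u:] * h)" by (simp add: mult.commute flip: \<open>1 = u * w\<close>)
  then show ?case using unit by (metis dvd_triv_left mult.left_commute)
next
  case (prime \<pi> x)
  have eq: "f * g = [:\<pi>:] * ([:x:] * h)" using prime.prems by (simp add: mult.commute)
  then have "[:\<pi>:] dvd f * g" by (simp only: dvd_triv_left)
  then have "[:\<pi>:] dvd f \<or> [:\<pi>:] dvd g"
    using lift_prime_elem_poly[OF prime.hyps(1)] unfolding prime_elem_def by blast
  then have "[:\<pi>:] dvd g" using assms(3) prime.hyps(1) by (auto simp: prime_elem_def)
  then obtain k where k: "g = [:\<pi>:] * k" by blast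
  have "[:\<pi>:] * (f * k) = [:\<pi>:] * ([:x:] * h)" using eq k by (simp only: mult.left_commute)
  moreover have "[:\<pi>:] \<noteq> 0" using prime.hyps(1) by auto
  ultimately have "f * k = [:x:] * h" using mult_left_cancel by blast
  then show ?case using prime by auto
qed

lemma primitive_part_exists:
  fixes f :: "'a::idom poly"
  assumes "wf (proper_divisors :: ('a \<times> 'a) set)" "f \<noteq> 0"
  obtains c g where "f = [:c:] * g" "\<And>a. [:a:] dvd g \<Longrightarrow> a dvd 1"
proof -
  have "\<exists>c g. f = [:c:] * g \<and> (\<forall>a. [:a:] dvd g \<longrightarrow> a dvd 1)"
    using poly_proper_divisors_wf[OF assms(1)] assms(2)
  proof (induction f rule: wf_induct_rule)
    case (less f)
    show ?case
    proof (cases "\<forall>a. [:a:] dvd f \<longrightarrow> a dvd 1")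
      case True
      then show ?thesis by (intro exI[of _ 1] exI[of _ f]) auto
    next
      case False
      then obtain a g where a: "f = [:a:] * g" "\<not> a dvd 1" by (auto elim!: dvdE)
      then have "(g, f) \<in> proper_divisors"
        using proper_divisor_cofactor_nonunit[of "[:a:]" g] less.prems
        by (simp add: is_unit_const_poly_iff mult.commute)
      then obtain c k where "g = [:c:] * k" "\<forall>a. [:a:] dvd k \<longrightarrow> a dvd 1"
        using less a by (metis mult_zero_right)
      then show ?thesis using a by (intro exI[of _ "a * c"] exI[of _ k]) (auto simp: mult.commute)
    qed
  qed
  then show ?thesis using that by blast
qed

text \<open>
  An irreducible \<open>f\<close> of positive degree is primitive.  If it divides \<open>g h\<close>, a nonzero element \<open>d\<close>
  of least degree in the ideal \<open>(f, g)\<close> plays the role of the greatest common divisor over the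
  fraction field: by pseudo-division its primitive part \<open>e\<close> divides everything in the ideal.
  If \<open>e\<close> is associated to \<open>f\<close>, then \<open>f\<close> divides \<open>g\<close>; if \<open>e\<close> is a unit, the ideal contains a
  nonzero constant \<open>d\<close>, and \<open>f\<close> divides \<open>d h\<close>, hence \<open>h\<close>.\<close>

lemma poly_irreducible_prime:
  fixes f :: "'a::idom poly"
  assumes wf: "wf (proper_divisors :: ('a \<times> 'a) set)"
    and irr: "\<And>p::'a. irreducible p \<Longrightarrow> prime_elem p"
    and f: "irreducible f"
  shows "prime_elem f"
proof (cases "degree f = 0")
  case True
  then obtain c where c: "f = [:c:]" by (auto elim: degree_eq_zeroE)
  have "irreducible c" unfolding irreducible_def
  proof (intro conjI allI impI)
    show "c \<noteq> 0" "\<not> c dvd 1" using f c by (auto simp: irreducible_def is_unit_const_poly_iff)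
    fix a b assume "c = a * b"
    then have "f = [:a:] * [:b:]" by (simp add: c)
    then show "a dvd 1 \<or> b dvd 1" using f by (metis irreducible_def is_unit_const_poly_iff)
  qed
  then show ?thesis using irr lift_prime_elem_poly c by auto
next
  case False
  have fact: "prime_product x" if "x \<noteq> 0" for x :: 'a
    using prime_product_if_irreducibles_prime wf irr that by blast
  have prim: "a dvd 1" if "[:a:] dvd f" for a
  proof -
    from that obtain g where g: "f = [:a:] * g" by blast
    then have "degree g \<noteq> 0" using False by (auto split: if_splits)
    then have "\<not> g dvd 1" by (auto simp: is_unit_poly_iff)
    moreover have "[:a:] dvd 1 \<or> g dvd 1" using f g unfolding irreducible_def by blast
    ultimately show ?thesis by (simp add: is_unit_const_poly_iff)
  qed
  have "f dvd g \<or> f dvd h" if gh: "f dvd g * h" for g h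
  proof -
    define J where "J = {u * f + v * g | u v. True}"
    have fJ: "f \<in> J" unfolding J_def by (rule CollectI, rule exI[of _ 1], rule exI[of _ 0]) simp
    have gJ: "g \<in> J" unfolding J_def by (rule CollectI, rule exI[of _ 0], rule exI[of _ 1]) simp
    define d where "d = arg_min degree (\<lambda>x. x \<in> J \<and> x \<noteq> 0)"
    have "f \<noteq> 0" using False by auto
    then have dJ: "d \<in> J" "d \<noteq> 0" and dmin: "\<And>x. x \<in> J \<Longrightarrow> x \<noteq> 0 \<Longrightarrow> degree d \<le> degree x"
      using arg_min_nat_lemma[of "\<lambda>x. x \<in> J \<and> x \<noteq> 0" f degree] fJ
      unfolding d_def by blast+
    obtain u v where uv: "d = u * f + v * g" using dJ by (auto simp: J_def)
    obtain c e where ce: "d = [:c:] * e" and e: "\<And>a. [:a:] dvd e \<Longrightarrow> a dvd 1"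
      using primitive_part_exists[OF wf dJ(2)] by metis
    have e_dvd: "e dvd x" if x: "x \<in> J" for x
    proof -
      obtain a q where aq: "a \<noteq> 0" "smult a x = d * q + pseudo_mod x d"
        using pseudo_mod(1)[OF dJ(2), of x] by blast
      obtain u' v' where uv': "x = u' * f + v' * g" using x by (auto simp: J_def)
      have "pseudo_mod x d = [:a:] * x - d * q" using aq by simp
      also have "\<dots> = ([:a:] * u' - q * u) * f + ([:a:] * v' - q * v) * g"
        unfolding uv uv' by (simp add: algebra_simps)
      finally have "pseudo_mod x d \<in> J" unfolding J_def by blast
      then have "pseudo_mod x d = 0" using dmin pseudo_mod(2)[OF dJ(2), of x] by fastforce
      then have "e * ([:c:] * q) = [:a:] * x" using aq(2) ce by simp
      then show ?thesis using primitive_dvd_const_mult[OF fact[OF aq(1)] aq(1) e] by blast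
    qed
    from e_dvd[OF fJ] obtain k where k: "f = e * k" by blast
    then consider "k dvd 1" | "e dvd 1" using f unfolding irreducible_def by blast
    then show ?thesis
    proof cases
      case 1
      then have "f dvd e" using k by (metis dvd_def mult.assoc mult.right_neutral)
      then show ?thesis using e_dvd[OF gJ] dvd_trans by blast
    next
      case 2
      then obtain b where b: "e = [:b:]" by (auto simp: is_unit_poly_iff)
      obtain t where t: "g * h = f * t" using gh by blast
      have "[:c * b:] * h = d * h" using ce b by (simp add: mult.commute)
      also have "\<dots> = f * (u * h + v * t)" using t unfolding uv
        by (simp add: algebra_simps)
      finally have "f * (u * h + v * t) = [:c * b:] * h" ..
      moreover have "c * b \<noteq> 0" using dJ(2) ce b by auto
      ultimately show ?thesis using primitive_dvd_const_mult[OF fact _ prim] by blast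
    qed
  qed
  then show ?thesis using f by (auto simp: prime_elem_def irreducible_def)
qed

lemma PID_poly_prime_product:
  assumes "is_PID TYPE('a::idom)" "(f::'a poly) \<noteq> 0"
  shows "prime_product f"
proof (rule prime_product_if_irreducibles_prime)
  show "wf (proper_divisors :: ('a poly \<times> 'a poly) set)"
    by (rule poly_proper_divisors_wf[OF PID_proper_divisors_wf[OF assms(1)]])
  show "prime_elem p" if "irreducible p" for p :: "'a poly"
    using poly_irreducible_prime[OF PID_proper_divisors_wf PID_irreducible_prime] assms(1) that
    by blast
qed fact

text \<open>
  The consequence of unique factorisation on which the computation of the kernel rests: the
  polynomial \<open>q\<close> is a non-zero-divisor modulo the constant \<open>p\<close> when the two have no common
  constant factor.  Primes of the coefficient ring are cancelled one at a time, as they stay prime among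
  polynomials.\<close>

lemma const_dvd_mult_cancel_coprime:
  fixes q x :: "'b::idom poly"
  assumes "prime_product p" "p \<noteq> 0"
    and "\<And>d. d dvd p \<Longrightarrow> [:d:] dvd q \<Longrightarrow> d dvd 1"
    and "[:p:] dvd q * x"
  shows "[:p:] dvd x"
  using assms
proof (induction p arbitrary: x rule: prime_product.induct)
  case (unit u)
  then have "[:u:] dvd 1" by (simp add: is_unit_const_poly_iff)
  then show ?case by (rule dvd_trans) simp
next
  case (prime \<pi> p)
  have "[:\<pi>:] dvd q * x" using prime.prems(3)
    by (rule dvd_trans[rotated]) simp
  moreover have "\<not> [:\<pi>:] dvd q" using prime.prems(2)[of \<pi>] prime.hyps(1)
    by (auto simp: prime_elem_def)
  ultimately have "[:\<pi>:] dvd x"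
    using lift_prime_elem_poly[OF prime.hyps(1)] unfolding prime_elem_def by blast
  then obtain y where y: "x = [:\<pi>:] * y" by blast
  have "[:\<pi>:] * [:p:] dvd [:\<pi>:] * (q * y)" using prime.prems(3) y by (simp add: mult.commute)
  moreover have "[:\<pi>:] \<noteq> 0" using prime.hyps(1) by auto
  ultimately have "[:p:] dvd q * y" using dvd_mult_cancel_left by blast
  moreover have "p \<noteq> 0" using prime.prems(1) by auto
  moreover have "d dvd 1" if "d dvd p" "[:d:] dvd q" for d
    using prime.prems(2)[of d] that by simp
  ultimately have "[:p:] dvd y" using prime.IH by blast
  then have "[:\<pi>:] * [:p:] dvd x" unfolding y by (rule mult_dvd_mono[OF dvd_refl])
  then show ?case by (simp add: mult.commute)
qed

section \<open>Algebra homomorphisms and generated subalgebras\<close>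

lemma subalgebra_adjoin: "subalgebra c (adjoin c T)"
  unfolding adjoin_def by (rule hull_in) (auto simp: subalgebra_def subset_eq)

lemma adjoin_gen: "t \<in> T \<Longrightarrow> t \<in> adjoin c T"
  unfolding adjoin_def by (rule hull_inc)

lemma adjoin_least: "T \<subseteq> S \<Longrightarrow> subalgebra c S \<Longrightarrow> adjoin c T \<subseteq> S"
  unfolding adjoin_def by (rule hull_minimal)

lemma adjoin_mono: "T \<subseteq> T' \<Longrightarrow> adjoin c T \<subseteq> adjoin c T'"
  unfolding adjoin_def by (rule hull_mono)

lemma adjoin_const: "c r \<in> adjoin c T"
  using subalgebra_adjoin[of c T] by (auto simp: subalgebra_def)

lemma adjoin_add: "x \<in> adjoin c T \<Longrightarrow> y \<in> adjoin c T \<Longrightarrow> x + y \<in> adjoin c T"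
  using subalgebra_adjoin[of c T] by (auto simp: subalgebra_def)

lemma adjoin_mult: "x \<in> adjoin c T \<Longrightarrow> y \<in> adjoin c T \<Longrightarrow> x * y \<in> adjoin c T"
  using subalgebra_adjoin[of c T] by (auto simp: subalgebra_def)

lemma adjoin_power:
  assumes "c 1 = 1" "x \<in> adjoin c T"
  shows "x ^ n \<in> adjoin c T"
proof (induction n)
  case 0
  then show ?case using adjoin_const[of c 1] assms by simp
qed (simp add: adjoin_mult assms)

lemmas adjoin_intros = adjoin_const adjoin_add adjoin_mult

definition algebra_hom ::
    "('a \<Rightarrow> 'b::comm_ring_1) \<Rightarrow> ('a \<Rightarrow> 'd::comm_ring_1) \<Rightarrow> ('b \<Rightarrow> 'd) \<Rightarrow> bool" where
  "algebra_hom c c' \<phi> \<longleftrightarrow>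
     (\<forall>x y. \<phi> (x + y) = \<phi> x + \<phi> y) \<and> (\<forall>x y. \<phi> (x * y) = \<phi> x * \<phi> y) \<and> (\<forall>r. \<phi> (c r) = c' r)"

lemma algebra_homD:
  assumes "algebra_hom c c' \<phi>"
  shows "\<phi> (x + y) = \<phi> x + \<phi> y" "\<phi> (x * y) = \<phi> x * \<phi> y" "\<phi> (c r) = c' r" "\<phi> 0 = 0"
    "\<phi> (- x) = - \<phi> x"
proof -
  show add: "\<phi> (x + y) = \<phi> x + \<phi> y" for x y using assms by (auto simp: algebra_hom_def)
  show "\<phi> (x * y) = \<phi> x * \<phi> y" "\<phi> (c r) = c' r" using assms by (auto simp: algebra_hom_def)
  show zero: "\<phi> 0 = 0" using add[of 0 0] by simp
  show "\<phi> (- x) = - \<phi> x" using add[of x "- x"] zero by (simp add: eq_neg_iff_add_eq_0 add.commute)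
qed

lemma adjoin_image:
  assumes "algebra_hom c c' \<phi>"
  shows "\<phi> ` adjoin c T = adjoin c' (\<phi> ` T)"
proof
  have "adjoin c T \<subseteq> {x. \<phi> x \<in> adjoin c' (\<phi> ` T)}"
    by (rule adjoin_least)
      (auto simp: subalgebra_def algebra_homD[OF assms] intro: adjoin_gen adjoin_intros)
  then show "\<phi> ` adjoin c T \<subseteq> adjoin c' (\<phi> ` T)" by blast
  show "adjoin c' (\<phi> ` T) \<subseteq> \<phi> ` adjoin c T"
  proof (rule adjoin_least)
    show "\<phi> ` T \<subseteq> \<phi> ` adjoin c T" using adjoin_gen by blast
    show "subalgebra c' (\<phi> ` adjoin c T)"
      unfolding subalgebra_def
    proof (intro conjI ballI)
      show "range c' \<subseteq> \<phi> ` adjoin c T"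
        using algebra_homD(3)[OF assms] adjoin_const by (metis image_eqI image_subsetI)
    qed (auto simp: algebra_homD[OF assms, symmetric] intro: adjoin_intros)
  qed
qed

lemma algebra_hom_eqI:
  assumes "algebra_hom c c' \<phi>" "algebra_hom c c' \<psi>" "\<And>t. t \<in> T \<Longrightarrow> \<phi> t = \<psi> t"
    and "x \<in> adjoin c T"
  shows "\<phi> x = \<psi> x"
proof -
  have "adjoin c T \<subseteq> {x. \<phi> x = \<psi> x}"
    by (rule adjoin_least)
      (use assms(3) in \<open>auto simp: subalgebra_def algebra_homD[OF assms(1)] algebra_homD[OF assms(2)]\<close>)
  then show ?thesis using assms(4) by blast
qed

lemma const3_simps:
  "const3 0 = 0" "const3 1 = 1" "const3 (r + s) = const3 r + const3 s"
  "const3 (r * s) = const3 r * const3 s" "const3 (- r) = - const3 r"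
  by (simp_all add: const3_def one_pCons)

lemma adjoin_X: "adjoin const3 {varX} = range (\<lambda>h. [:[:h:]:])"
proof
  show "adjoin const3 {varX} \<subseteq> range (\<lambda>h::'a poly. [:[:h:]:])"
    by (rule adjoin_least)
      (auto simp: varX_def subalgebra_def const3_def image_iff)
  show "range (\<lambda>h. [:[:h:]:]) \<subseteq> adjoin const3 {varX :: 'a poly3}"
  proof safe
    fix h :: "'a poly"
    show "[:[:h:]:] \<in> adjoin const3 {varX}"
    proof (induction h)
      case 0
      then show ?case using adjoin_const[of const3 0] by (simp add: const3_simps)
    next
      case (pCons a h)
      have "[:[:pCons a h:]:] = const3 a + varX * [:[:h:]:]" by (simp add: const3_def varX_def)
      then show ?case using pCons.IH
      by (metis adjoin_add adjoin_mult adjoin_const adjoin_gen insertI1 insertI2)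
    qed
  qed
qed

lemma adjoin_XY: "adjoin const3 {varX, varY} = range (\<lambda>g. [:g:])"
proof
  show "adjoin const3 {varX, varY} \<subseteq> range (\<lambda>g::'a poly poly. [:g:])"
    by (rule adjoin_least)
      (auto simp: varX_def varY_def subalgebra_def const3_def image_iff)
  show "range (\<lambda>g. [:g:]) \<subseteq> adjoin const3 {varX, varY :: 'a poly3}"
  proof safe
    fix g :: "'a poly poly"
    show "[:g:] \<in> adjoin const3 {varX, varY}"
    proof (induction g)
      case 0
      then show ?case using adjoin_const[of const3 0] by (simp add: const3_simps)
    next
      case (pCons h g)
      have "[:[:h:]:] \<in> adjoin const3 {varX, varY}"
        using adjoin_X adjoin_mono[of "{varX}" "{varX, varY}" const3] by blast
      moreover have "[:pCons h g:] = [:[:h:]:] + varY * [:g:]" by (simp add: varY_def)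
      ultimately show ?case using pCons.IH
      by (metis adjoin_add adjoin_mult adjoin_const adjoin_gen insertI1 insertI2)
    qed
  qed
qed

lemma adjoin_XYZ: "adjoin const3 {varX, varY, varZ} = (UNIV :: 'a::comm_ring_1 poly3 set)"
proof -
  have "F \<in> adjoin const3 {varX, varY, varZ}" for F :: "'a poly3"
  proof (induction F)
    case 0
    then show ?case using adjoin_const[of const3 0] by (simp add: const3_simps)
  next
    case (pCons g F)
    have "[:g:] \<in> adjoin const3 {varX, varY, varZ}"
      using adjoin_XY adjoin_mono[of "{varX, varY}" "{varX, varY, varZ}" const3] by blast
    moreover have "pCons g F = [:g:] + varZ * F" by (simp add: varZ_def)
    ultimately show ?case using pCons.IH
      by (metis adjoin_add adjoin_mult adjoin_const adjoin_gen insertI1 insertI2)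
  qed
  then show ?thesis by blast
qed

lemma poly3_hom_eqI:
  assumes "algebra_hom const3 c \<phi>" "algebra_hom const3 c \<psi>"
    and "\<phi> varX = \<psi> varX" "\<phi> varY = \<psi> varY" "\<phi> varZ = \<psi> varZ"
  shows "\<phi> F = \<psi> F"
  by (rule algebra_hom_eqI[OF assms(1,2), of "{varX, varY, varZ}"])
    (use assms adjoin_XYZ in auto)

subsection \<open>Substitution homomorphisms\<close>

definition const_hom :: "('a::comm_ring_1 \<Rightarrow> 'b::comm_ring_1) \<Rightarrow> bool" where
  "const_hom c \<longleftrightarrow> c 1 = 1 \<and> algebra_hom id c c"

definition eval_poly_hom :: "('a::comm_ring_1 \<Rightarrow> 'b::comm_ring_1) \<Rightarrow> 'b \<Rightarrow> 'a poly \<Rightarrow> 'b" where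
  "eval_poly_hom c x f = poly (map_poly c f) x"

lemma eval_poly_hom_pCons:
  assumes "const_hom c"
  shows "eval_poly_hom c x (pCons a f) = c a + x * eval_poly_hom c x f" "eval_poly_hom c x 0 = 0"
    "eval_poly_hom c x [:a:] = c a"
  using assms algebra_homD(4)[of id c c]
  by (auto simp: const_hom_def eval_poly_hom_def map_poly_pCons)

lemma const_hom_eval_poly:
  assumes c: "const_hom c"
  shows "const_hom (eval_poly_hom c x)"
proof -
  note s = eval_poly_hom_pCons[OF c]
  have h: "c 1 = 1" "c (a + b) = c a + c b" "c (a * b) = c a * c b" "c 0 = 0" for a b
    using c algebra_homD[of id c c] by (auto simp: const_hom_def)
  have add: "eval_poly_hom c x (f + g) = eval_poly_hom c x f + eval_poly_hom c x g" for f g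
    by (induction f g rule: poly_induct2) (simp_all add: s h algebra_simps)
  have smult: "eval_poly_hom c x (smult a g) = c a * eval_poly_hom c x g" for a g
    by (induction g) (simp_all add: s h algebra_simps)
  have "eval_poly_hom c x (f * g) = eval_poly_hom c x f * eval_poly_hom c x g" for f g
    by (induction f) (simp_all add: s h add smult algebra_simps)
  moreover have "eval_poly_hom c x 1 = 1" by (simp add: one_pCons s h)
  ultimately show ?thesis using add by (simp add: const_hom_def algebra_hom_def)
qed

text \<open>The universal property of \<open>R[X][Y][Z]\<close>: \<open>subst3 c x y z\<close> is the map extending \<open>c\<close> that
  sends \<open>X, Y, Z\<close> to \<open>x, y, z\<close>.\<close>

definition subst3 :: "('a::comm_ring_1 \<Rightarrow> 'b::comm_ring_1) \<Rightarrow> 'b \<Rightarrow> 'b \<Rightarrow> 'b \<Rightarrow> 'a poly3 \<Rightarrow> 'b" where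
  "subst3 c x y z = eval_poly_hom (eval_poly_hom (eval_poly_hom c x) y) z"

lemma subst3_hom:
  assumes "const_hom c"
  shows "algebra_hom const3 c (subst3 c x y z)"
    "subst3 c x y z varX = x" "subst3 c x y z varY = y" "subst3 c x y z varZ = z"
    "subst3 c x y z [:g:] = poly (map_poly (\<lambda>h. subst3 c x y z [:[:h:]:]) g) y"
proof -
  note h = assms const_hom_eval_poly
  have "subst3 c x y z (const3 r) = c r" for r
    by (simp add: subst3_def const3_def eval_poly_hom_pCons h)
  then show "algebra_hom const3 c (subst3 c x y z)"
    using h(2)[OF h(2)[OF h(2)[OF h(1), of x], of y], of z]
    by (simp add: const_hom_def algebra_hom_def subst3_def)
  have one: "d 1 = 1" "d 0 = 0" if "const_hom d" for d :: "'e::comm_ring_1 \<Rightarrow> 'b"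
    using that algebra_homD(4)[of id d d] by (auto simp: const_hom_def)
  show "subst3 c x y z varX = x" "subst3 c x y z varY = y" "subst3 c x y z varZ = z"
    by (simp_all add: subst3_def varX_def varY_def varZ_def eval_poly_hom_pCons h one)
  show "subst3 c x y z [:g:] = poly (map_poly (\<lambda>h. subst3 c x y z [:[:h:]:]) g) y"
    by (simp add: subst3_def eval_poly_hom_pCons h) (simp add: eval_poly_hom_def[abs_def])
qed

lemma const_hom_const3: "const_hom const3"
  by (simp add: const_hom_def algebra_hom_def const3_simps)

lemma const_hom_id: "const_hom id"
  by (simp add: const_hom_def algebra_hom_def)

lemma const_hom_to_fract: "const_hom to_fract"
  by (simp add: const_hom_def algebra_hom_def)

lemma const_hom_map_poly:
  assumes "const_hom c"
  shows "const_hom (map_poly c)"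
proof -
  have c0: "c 0 = 0" using assms algebra_homD(4)[of id c c] by (simp add: const_hom_def)
  have C: "const_hom (\<lambda>a. [:c a:])"
    using assms by (simp add: const_hom_def algebra_hom_def one_pCons)
  have "map_poly c f = eval_poly_hom (\<lambda>a. [:c a:]) [:0, 1:] f" for f
    by (induction f) (simp_all add: eval_poly_hom_pCons C map_poly_pCons c0)
  then have "map_poly c = eval_poly_hom (\<lambda>a. [:c a:]) [:0, 1:]" by blast
  then show ?thesis using const_hom_eval_poly[OF C] by simp
qed

lemma inj_map_poly:
  assumes "inj c" "c 0 = 0"
  shows "inj (map_poly c)"
proof (rule injI)
  fix f g assume "map_poly c f = map_poly c g"
  then have "c (coeff f n) = c (coeff g n)" for n
    using assms(2) by (metis coeff_map_poly)
  then show "f = g" using assms(1) by (auto simp: poly_eq_iff inj_def)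
qed

lemma map_poly_eq_constD:
  assumes "inj c" "c 0 = 0" "map_poly c f = [:a:]"
  obtains a' where "f = [:a':]" "c a' = a"
proof -
  have "coeff f n = 0" if "n > 0" for n
  proof -
    have "c (coeff f n) = c 0"
      using arg_cong[OF assms(3), of "\<lambda>p. coeff p n"] that assms(2)
      by (simp add: coeff_map_poly coeff_pCons split: nat.splits)
    then show ?thesis using assms(1) by (auto simp: inj_def)
  qed
  then have "f = [:coeff f 0:]" by (auto simp: poly_eq_iff coeff_pCons split: nat.splits)
  moreover have "c (coeff f 0) = a"
    using arg_cong[OF assms(3), of "\<lambda>p. coeff p 0"] assms(2) by (simp add: coeff_map_poly)
  ultimately show ?thesis using that by blast
qed

lemma to_fract_inj0: "inj to_fract" "to_fract 0 = 0"
  by (auto intro!: injI)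

lemma to_fract3_hom:
  "algebra_hom const3 (\<lambda>r. const3 (to_fract r)) to_fract3"
  "to_fract3 varX = varX" "to_fract3 varY = varY" "to_fract3 varZ = varZ"
proof -
  show "algebra_hom const3 (\<lambda>r. const3 (to_fract r)) to_fract3"
    using const_hom_map_poly[OF const_hom_map_poly[OF const_hom_map_poly[OF const_hom_to_fract]]]
    by (simp add: const_hom_def algebra_hom_def to_fract3_def const3_def map_poly_pCons)
  show "to_fract3 varX = varX" "to_fract3 varY = varY" "to_fract3 varZ = varZ"
    by (simp_all add: to_fract3_def varX_def varY_def varZ_def map_poly_pCons)
qed

lemma inj_to_fract3: "inj to_fract3"
  unfolding to_fract3_def by (intro inj_map_poly to_fract_inj0 map_poly_0)

text \<open>
  This and the next lemma are \<open>R[X, Y, Z] \<inter> K[X, Y] = R[X, Y]\<close> and \<open>R[X, Y, Z] \<inter> K[X] = R[X]\<close>,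
  up to the embedding.  They carry the hypotheses on \<open>D'\<close> from \<open>K\<close> back to \<open>R\<close>.\<close>

lemma to_fract3_adjoin_XY_descends:
  assumes "to_fract3 F \<in> adjoin const3 {varX, varY}"
  obtains g where "F = [:g:]"
proof -
  obtain g' where "to_fract3 F = [:g':]" using assms unfolding adjoin_XY by blast
  then have "map_poly (map_poly (map_poly to_fract)) F = [:g':]" by (simp only: to_fract3_def)
  from map_poly_eq_constD[OF inj_map_poly[OF inj_map_poly[OF to_fract_inj0] map_poly_0] map_poly_0 this]
  show ?thesis using that by blast
qed

lemma to_fract3_adjoin_X_descends:
  assumes "to_fract3 F \<in> adjoin const3 {varX}"
  obtains h where "F = [:[:h:]:]"
proof -
  obtain h' where "to_fract3 F = [:[:h':]:]" using assms unfolding adjoin_X by blast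
  then have "map_poly (map_poly (map_poly to_fract)) F = [:[:h':]:]" by (simp only: to_fract3_def)
  from map_poly_eq_constD[OF inj_map_poly[OF inj_map_poly[OF to_fract_inj0] map_poly_0] map_poly_0 this]
  obtain g where g: "F = [:g:]" "map_poly (map_poly to_fract) g = [:h':]" by metis
  from map_poly_eq_constD[OF inj_map_poly[OF to_fract_inj0] map_poly_0 g(2)]
  show ?thesis using that g(1) by blast
qed

section \<open>Triangular derivations\<close>

lemma derivationD:
  assumes "derivation c D"
  shows "D (f + g) = D f + D g" "D (f * g) = f * D g + g * D f" "D (c r) = 0" "D 0 = 0"
    "D (- f) = - D f"
proof -
  show add: "D (f + g) = D f + D g" for f g using assms by (auto simp: derivation_def)
  show "D (f * g) = f * D g + g * D f" "D (c r) = 0" using assms by (auto simp: derivation_def)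
  show zero: "D 0 = 0" using add[of 0 0] by simp
  show "D (- f) = - D f" using add[of f "- f"] zero by (simp add: eq_neg_iff_add_eq_0 add.commute)
qed

lemma kernel_subalgebra:
  assumes "derivation c D"
  shows "subalgebra c (kernel D)"
  by (auto simp: subalgebra_def kernel_def derivationD[OF assms])

text \<open>
  These are the derivations \<open>p(X) \<partial>/\<partial>Y + q(X, Y) \<partial>/\<partial>Z\<close>.  In the representation as
  \<open>R[X][Y][Z]\<close>, \<open>pderiv\<close> is \<open>\<partial>/\<partial>Z\<close>, and \<open>\<partial>/\<partial>Y\<close> is \<open>pderiv\<close> applied to each coefficient.\<close>

locale triangular_derivation =
  fixes D :: "'a::idom poly3 \<Rightarrow> 'a poly3" and p :: "'a poly" and q :: "'a poly poly"
  assumes D: "derivation const3 D"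
    and DX: "D varX = 0" and DY: "D varY = [:[:p:]:]" and DZ: "D varZ = [:q:]"
begin

lemma D_const: "D [:[:h:]:] = 0"
  using adjoin_least[OF _ kernel_subalgebra[OF D], of "{varX}"] DX
  unfolding adjoin_X by (auto simp: kernel_def)

lemma D_pderiv: "D [:g:] = [:smult p (pderiv g):]"
proof (induction g)
  case 0
  then show ?case using derivationD(4)[OF D] by simp
next
  case (pCons h g)
  have "[:pCons h g:] = [:[:h:]:] + varY * [:g:]" by (simp add: varY_def)
  then have "D [:pCons h g:] = varY * D [:g:] + [:g:] * [:[:p:]:]"
    by (simp only: derivationD[OF D] D_const DY add_0_left)
  then show ?case using pCons by (simp add: varY_def pderiv_pCons algebra_simps smult_add_right)
qed

lemma coeff_D:
  "coeff (D F) i = smult p (pderiv (coeff F i)) + of_nat (Suc i) * (q * coeff F (Suc i))"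
proof (induction F arbitrary: i)
  case 0
  then show ?case using derivationD(4)[OF D] by simp
next
  case (pCons g F)
  have "pCons g F = [:g:] + varZ * F" by (simp add: varZ_def)
  then have "D (pCons g F) = [:smult p (pderiv g):] + (varZ * D F + F * [:q:])"
    by (simp only: derivationD[OF D] D_pderiv DZ)
  then show ?case using pCons.IH
    by (cases i) (simp_all add: varZ_def coeff_pCons algebra_simps)
qed

text \<open>
  A common factor of \<open>p\<close> and \<open>q\<close> divides every value of \<open>D\<close>.\<close>

lemma irreducible_imp_coprime:
  assumes "\<not> reducible_der D" "e dvd [:p:]" "e dvd q"
  shows "e dvd 1"
proof -
  have "[:e:] dvd D F" for F
    unfolding const_poly_dvd_iff coeff_D
  proof (intro allI dvd_add)
    fix n
    have "e dvd [:p:] * pderiv (coeff F n)" using assms(2) by (rule dvd_mult2)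
    then show "e dvd smult p (pderiv (coeff F n))" by simp
    show "e dvd of_nat (Suc n) * (q * coeff F (Suc n))" using assms(3) by (intro dvd_mult dvd_mult2)
  qed
  then have "range D \<subseteq> {[:e:] * x | x. True}" by (auto simp: dvd_def)
  then have "[:e:] dvd 1" using assms(1) unfolding reducible_der_def by blast
  then show ?thesis by (simp add: is_unit_const_poly_iff)
qed

text \<open>
  Here \<open>D = q \<partial>/\<partial>Z\<close> with \<open>q \<noteq> 0\<close>, because \<open>0\<close> is a non-unit dividing all values of the zero
  derivation.\<close>

lemma kernel_if_p_zero:
  assumes "\<not> reducible_der D" "p = 0" and unit: "\<And>n. of_nat (Suc n) dvd (1::'a)"
  shows "kernel D = adjoin const3 {varX, varY}"
proof -
  have "q dvd 1" using irreducible_imp_coprime[OF assms(1), of q] assms(2) by simp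
  then have "q \<noteq> 0" by auto
  have nat: "of_nat (Suc n) \<noteq> (0::'a poly poly)" for n
    using unit[of n] by (auto simp: of_nat_poly simp del: of_nat_Suc)
  have "D F = 0 \<longleftrightarrow> (\<exists>g. F = [:g:])" for F
  proof
    assume "D F = 0"
    then have "of_nat (Suc n) * (q * coeff F (Suc n)) = 0" for n
      using coeff_D[of F n] assms(2) by simp
    then have "coeff F (Suc n) = 0" for n using nat \<open>q \<noteq> 0\<close> by (metis mult_eq_0_iff)
    then have "F = [:coeff F 0:]" by (auto simp: poly_eq_iff coeff_pCons split: nat.splits)
    then show "\<exists>g. F = [:g:]" by blast
  qed (auto simp: D_pderiv assms(2))
  then show ?thesis unfolding adjoin_XY kernel_def by auto
qed

text \<open>
  By \<open>coeff_D\<close>, membership in the kernel means \<open>p F\<^sub>j' = - (j + 1) q F\<^sub>j\<^sub>+\<^sub>1\<close> for the coefficients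
  \<open>F\<^sub>j \<in> R[X][Y]\<close> of \<open>F\<close>.  If \<open>p\<^sup>k\<close> divides \<open>F\<^sub>j\<close> for all \<open>j \<ge> k\<close>, it can be cancelled from these
  equations, and coprimality yields one more factor \<open>p\<close> in \<open>F\<^sub>j\<^sub>+\<^sub>1\<close>.\<close>

lemma power_p_dvd_coeff_kernel:
  assumes unit: "\<And>n. of_nat (Suc n) dvd (1::'a)"
    and coprime: "\<And>x. [:p:] dvd q * x \<Longrightarrow> [:p:] dvd x" and "p \<noteq> 0"
    and F: "D F = 0" and "k \<le> i"
  shows "[:p ^ k:] dvd coeff F i"
  using \<open>k \<le> i\<close>
proof (induction k arbitrary: i)
  case 0
  then show ?case by (simp flip: one_pCons)
next
  case (Suc k)
  then obtain j where j: "i = Suc j" "k \<le> j" by (metis Suc_le_D Suc_le_mono)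
  from Suc.IH[OF j(2)] Suc.IH[of i] Suc.prems obtain H H' where
    H: "coeff F j = [:p ^ k:] * H" "coeff F i = [:p ^ k:] * H'" by (metis Suc_leD dvdE)
  have "smult p (pderiv (coeff F j)) + of_nat (Suc j) * (q * coeff F i) = 0"
    using coeff_D[of F j] F j by simp
  then have "[:p ^ k:] * ([:p:] * pderiv H + of_nat (Suc j) * (q * H')) = 0"
    unfolding H by (simp add: pderiv_smult smult_add_right algebra_simps)
  then have "[:p:] * pderiv H + of_nat (Suc j) * (q * H') = 0"
    using \<open>p \<noteq> 0\<close> by simp
  then have "of_nat (Suc j) * (q * H') = [:p:] * (- pderiv H)"
    by (simp add: add_eq_0_iff)
  then have dvd: "[:p:] dvd of_nat (Suc j) * (q * H')" by (metis dvd_triv_left)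
  obtain u where u: "1 = of_nat (Suc j) * (u :: 'a)" using unit by blast
  have "[:[:u:]:] * of_nat (Suc j) = 1"
    using u by (simp add: of_nat_poly one_pCons mult.commute)
  then have "q * H' = [:[:u:]:] * (of_nat (Suc j) * (q * H'))"
    by (simp add: mult.assoc [symmetric])
  then have "[:p:] dvd q * H'" using dvd by (metis dvd_mult)
  then have "[:p:] dvd H'" by (rule coprime)
  then have "[:p ^ k:] * [:p:] dvd coeff F i" unfolding H by (rule mult_dvd_mono[OF dvd_refl])
  then show ?case by (simp add: mult.commute)
qed

text \<open>
  Put \<open>w = p Z - P\<close>.  The top coefficient of a kernel element of degree \<open>n\<close> in \<open>Z\<close> does not involve
  \<open>Y\<close> and is divisible by \<open>p\<^sup>n\<close>, the top coefficient of \<open>w\<^sup>n\<close>.  So a multiple of \<open>w\<^sup>n\<close> by an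
  element of \<open>R[X]\<close> removes it, and induction on the degree applies.\<close>

lemma kernel_if_p_nonzero:
  assumes unit: "\<And>n. of_nat (Suc n) dvd (1::'a)"
    and coprime: "\<And>x. [:p:] dvd q * x \<Longrightarrow> [:p:] dvd x" and p: "p \<noteq> 0"
    and P: "pderiv P = q"
  shows "kernel D = adjoin const3 {varX, [:[:p:]:] * varZ + [:- P:]}"
proof
  define w where "w = [:[:p:]:] * varZ + [:- P:]"
  have w: "w = [:- P, [:p:]:]" by (simp add: w_def varZ_def)
  have Dw: "D w = 0"
    unfolding w_def derivationD[OF D] D_const DZ D_pderiv by (simp add: P pderiv_minus)
  then have "{varX, w} \<subseteq> kernel D" using DX by (simp add: kernel_def)
  then show "adjoin const3 {varX, [:[:p:]:] * varZ + [:- P:]} \<subseteq> kernel D"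
    unfolding w_def [symmetric] by (rule adjoin_least[OF _ kernel_subalgebra[OF D]])
  have const_in: "[:[:h:]:] \<in> adjoin const3 {varX, w}" for h
    using adjoin_X adjoin_mono[of "{varX}" "{varX, w}" const3] by blast
  have pderiv0: "\<exists>h. g = [:h:]" if "smult p (pderiv g) = 0" for g
  proof -
    have "coeff g (Suc n) = 0" for n
    proof -
      have "pderiv g = 0" using that p by simp
      then have "of_nat (Suc n) * coeff g (Suc n) = 0" by (metis coeff_0 coeff_pderiv)
      moreover have "of_nat (Suc n) \<noteq> (0::'a poly)" using unit[of n] by (auto simp: of_nat_poly simp del: of_nat_Suc)
      ultimately show ?thesis using mult_eq_0_iff by blast
    qed
    then have "g = [:coeff g 0:]" by (auto simp: poly_eq_iff coeff_pCons split: nat.splits)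
    then show ?thesis by blast
  qed
  have "F \<in> adjoin const3 {varX, w}" if "D F = 0" for F
    using that
  proof (induction "degree F" arbitrary: F rule: less_induct)
    case less
    define n where "n = degree F"
    have "smult p (pderiv (coeff F n)) = 0"
      using coeff_D[of F n] less.prems by (simp add: n_def coeff_eq_0)
    then obtain h where h: "coeff F n = [:h:]" using pderiv0 by blast
    show ?case
    proof (cases "n = 0")
      case True
      then have "F = [:[:h:]:]" using h by (metis degree_eq_zeroE coeff_pCons_0 n_def)
      then show ?thesis using const_in by simp
    next
      case False
      have "[:p ^ n:] dvd [:h:]"
        using power_p_dvd_coeff_kernel[OF unit coprime p less.prems, of n n] h by simp
      then obtain k where k: "h = p ^ n * k" by (auto elim: dvdE)
      define G where "G = F + - ([:[:k:]:] * w ^ n)"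
      have deg: "degree (w ^ n) = n" using p by (simp add: degree_power_eq w)
      have lead: "coeff (w ^ n) n = [:p ^ n:]"
        using deg lead_coeff_power[of w n] p by (simp add: w poly_const_pow)
      have "degree G \<le> n" unfolding G_def
        by (intro degree_add_le) (use deg degree_smult_le[of "[:k:]" "w ^ n"] in \<open>simp_all add: n_def\<close>)
      moreover have "coeff G n = 0" using lead h by (simp add: G_def k mult.commute)
      ultimately have "degree G < n" using False
        by (metis le_neq_implies_less leading_coeff_0_iff degree_0)
      moreover have "w ^ n \<in> kernel D"
        using adjoin_power[of const3 w "{w}" n] adjoin_least[OF _ kernel_subalgebra[OF D], of "{w}"] Dw
        by (auto simp: kernel_def const3_simps adjoin_gen)
      then have "D G = 0"
        unfolding G_def derivationD[OF D] D_const less.prems by (simp add: kernel_def)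
      ultimately have "G \<in> adjoin const3 {varX, w}" using less.hyps by (simp add: n_def)
      moreover have "w ^ n \<in> adjoin const3 {varX, w}"
        by (rule adjoin_power) (auto simp: const3_simps adjoin_gen)
      moreover have "F = G + [:[:k:]:] * w ^ n" by (simp add: G_def)
      ultimately show ?thesis using const_in by (metis adjoin_add adjoin_mult)
    qed
  qed
  then show "kernel D \<subseteq> adjoin const3 {varX, [:[:p:]:] * varZ + [:- P:]}"
    by (auto simp: kernel_def w_def)
qed

end

lemma antiderivative_exists:
  assumes "\<And>n. of_nat (Suc n) dvd (1::'b::idom)"
  obtains P where "pderiv P = (q :: 'b poly)"
proof -
  have "\<forall>n. \<exists>u. of_nat (Suc n) * u = (1::'b)" using assms by (metis dvdE)
  then obtain u where u: "\<And>n. of_nat (Suc n) * u n = (1::'b)" by metis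
  define P where "P = (\<Sum>i\<le>degree q. monom (u i * coeff q i) (Suc i))"
  have "coeff P (Suc n) = u n * coeff q n" for n
    by (simp add: P_def coeff_sum coeff_eq_0)
  then have "of_nat (Suc n) * coeff P (Suc n) = coeff q n" for n
    using u[of n] by (simp add: mult.assoc[symmetric] del: of_nat_Suc)
  then have "pderiv P = q" by (simp add: poly_eq_iff coeff_pderiv del: of_nat_Suc)
  then show ?thesis using that by blast
qed

lemma contains_rationals_of_nat_unit:
  assumes "contains_rationals TYPE('a::comm_ring_1)"
  shows "of_nat (Suc n) dvd (1::'a)"
proof -
  obtain h :: "rat \<Rightarrow> 'a" where h: "h 1 = 1" "\<And>x y. h (x + y) = h x + h y" "\<And>x y. h (x * y) = h x * h y"
    using assms by (auto simp: contains_rationals_def)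
  have h0: "h 0 = 0" using h(2)[of 0 0] by simp
  have "h (of_nat m) = of_nat m" for m by (induction m) (simp_all add: h h0)
  then have "of_nat (Suc n) * h (1 / of_nat (Suc n)) = h (of_nat (Suc n) * (1 / of_nat (Suc n)))"
    by (metis h(3))
  also have "\<dots> = 1" using h by (simp del: of_nat_Suc)
  finally show ?thesis by (metis dvd_triv_left)
qed

lemma (in triangular_derivation) irreducible_kernel:
  assumes "is_PID TYPE('a)" "contains_rationals TYPE('a)" "\<not> reducible_der D"
  obtains b P where "kernel D = adjoin const3 {varX, [:[:b:]:] * varZ + [:P:]}"
proof (cases "p = 0")
  case True
  \<comment> \<open>The kernel is \<open>R[X, Y]\<close>, so the second generator is \<open>0 Z + Y\<close>.\<close>
  then show ?thesis using kernel_if_p_zero[OF assms(3) _ contains_rationals_of_nat_unit[OF assms(2)]] that[of 0 "[:0, 1:]"] by (simp add: varY_def)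
next
  case False
  note unit = contains_rationals_of_nat_unit[OF assms(2)]
  have "of_nat (Suc n) dvd (1::'a poly)" for n
    using unit[of n] by (simp add: of_nat_poly is_unit_const_poly_iff del: of_nat_Suc)
  then obtain P where "pderiv P = q" using antiderivative_exists by blast
  moreover have "[:p:] dvd x" if "[:p:] dvd q * x" for x
  proof (rule const_dvd_mult_cancel_coprime[OF PID_poly_prime_product[OF assms(1) False] False _ that])
    fix d assume "d dvd p" "[:d:] dvd q"
    then have "[:d:] dvd 1" using irreducible_imp_coprime[OF assms(3), of "[:d:]"] by simp
    then show "d dvd 1" by (simp add: is_unit_const_poly_iff)
  qed
  ultimately show ?thesis using kernel_if_p_nonzero[OF unit _ False] that by blast
qed

section \<open>Linear changes of the first two variables\<close>

definition linear_subst :: "'a::comm_ring_1 \<Rightarrow> 'a \<Rightarrow> 'a \<Rightarrow> 'a \<Rightarrow> 'a poly3 \<Rightarrow> 'a poly3" where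
  "linear_subst a b c d =
     subst3 const3 (const3 a * varX + const3 b * varY) (const3 c * varX + const3 d * varY) varZ"

lemma linear_subst_hom: "algebra_hom const3 const3 (linear_subst a b c d)"
  unfolding linear_subst_def by (rule subst3_hom[OF const_hom_const3])

lemma linear_subst_vars:
  "linear_subst a b c d varX = const3 a * varX + const3 b * varY"
  "linear_subst a b c d varY = const3 c * varX + const3 d * varY"
  "linear_subst a b c d varZ = varZ"
  unfolding linear_subst_def by (rule subst3_hom[OF const_hom_const3])+

lemma linear_subst_poly:
  "linear_subst a b c d [:g:] =
     poly (map_poly (\<lambda>h. linear_subst a b c d [:[:h:]:]) g) (linear_subst a b c d varY)"
  unfolding linear_subst_vars unfolding linear_subst_def by (rule subst3_hom[OF const_hom_const3])

lemmas linear_subst_simps = linear_subst_vars algebra_homD[OF linear_subst_hom]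

text \<open>A matrix of determinant \<open>1\<close> is inverted by its adjugate.\<close>

lemma linear_subst_inverse:
  assumes "a * d - b * c = 1"
  shows "linear_subst d (- b) (- c) a (linear_subst a b c d F) = F"
proof (rule poly3_hom_eqI[of const3 "\<lambda>F. linear_subst d (- b) (- c) a (linear_subst a b c d F)" "\<lambda>F. F"])
  show "algebra_hom const3 const3 (\<lambda>F. linear_subst d (- b) (- c) a (linear_subst a b c d F))"
    by (simp add: algebra_hom_def linear_subst_simps)
  show "algebra_hom const3 const3 (\<lambda>F. F)" by (simp add: algebra_hom_def)
  have det: "const3 a * const3 d - const3 b * const3 c = const3 1"
    unfolding assms[symmetric] by (simp add: const3_def)
  have "linear_subst d (- b) (- c) a (linear_subst a b c d varX)
      = (const3 a * const3 d - const3 b * const3 c) * varX"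
    by (simp add: linear_subst_simps const3_simps algebra_simps)
  then show "linear_subst d (- b) (- c) a (linear_subst a b c d varX) = varX"
    by (simp only: det const3_simps mult_1)
  have "linear_subst d (- b) (- c) a (linear_subst a b c d varY)
      = (const3 a * const3 d - const3 b * const3 c) * varY"
    by (simp add: linear_subst_simps const3_simps algebra_simps)
  then show "linear_subst d (- b) (- c) a (linear_subst a b c d varY) = varY"
    by (simp only: det const3_simps mult_1)
  show "linear_subst d (- b) (- c) a (linear_subst a b c d varZ) = varZ"
    by (simp add: linear_subst_simps)
qed

lemma to_fract3_linear_subst:
  "to_fract3 (linear_subst a b c d F)
     = linear_subst (to_fract a) (to_fract b) (to_fract c) (to_fract d) (to_fract3 F)"
proof -
  note h = algebra_homD[OF to_fract3_hom(1)] to_fract3_hom(2-4)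
  show ?thesis
    by (rule poly3_hom_eqI[of "\<lambda>r. const3 (to_fract r)" "\<lambda>F. to_fract3 (linear_subst a b c d F)"
          "\<lambda>F. linear_subst (to_fract a) (to_fract b) (to_fract c) (to_fract d) (to_fract3 F)"])
      (simp_all add: algebra_hom_def linear_subst_simps h)
qed

lemma linear_form_in_adjoin: "linear_form_XY L \<Longrightarrow> L \<in> adjoin const3 {varX, varY}"
  unfolding linear_form_XY_def by (auto simp: adjoin_intros adjoin_gen)

lemma linear_subst_adjoin_XY: "linear_subst a b c d ` adjoin const3 {varX, varY} \<subseteq> adjoin const3 {varX, varY}"
  unfolding adjoin_image[OF linear_subst_hom]
  by (rule adjoin_least[OF _ subalgebra_adjoin])
    (auto simp: linear_subst_vars adjoin_intros adjoin_gen)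

text \<open>
  A nonzero common zero \<open>(u, v)\<close> of the two forms would give two points, \<open>(u, v, 0)\<close> and the
  origin, that no polynomial in the two forms and \<open>Z\<close> separates; but \<open>X\<close> or \<open>Y\<close> does.\<close>

lemma coordinate_linear_forms_det:
  fixes \<alpha> \<beta> \<gamma> \<delta> :: "'k::idom"
  assumes "coordinate_system const3 3
    [const3 \<alpha> * varX + const3 \<beta> * varY, const3 \<gamma> * varX + const3 \<delta> * varY, varZ]"
  shows "\<alpha> * \<delta> - \<beta> * \<gamma> \<noteq> 0"
proof
  assume det: "\<alpha> * \<delta> - \<beta> * \<gamma> = 0"
  obtain u v where uv: "u \<noteq> 0 \<or> v \<noteq> 0" "\<alpha> * u + \<beta> * v = 0" "\<gamma> * u + \<delta> * v = 0"
  proof -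
    consider "\<beta> \<noteq> 0 \<or> - \<alpha> \<noteq> 0" | "\<alpha> = 0" "\<beta> = 0" "\<delta> \<noteq> 0 \<or> - \<gamma> \<noteq> 0"
      | "\<alpha> = 0" "\<beta> = 0" "\<gamma> = 0" "\<delta> = 0" by auto
    then show ?thesis
    proof cases
      case 1
      moreover have "\<alpha> * \<beta> + \<beta> * (- \<alpha>) = 0" "\<gamma> * \<beta> + \<delta> * (- \<alpha>) = 0"
        using det by (simp_all add: mult.commute)
      ultimately show ?thesis by (rule that)
    next
      case 2
      then show ?thesis by (intro that[of \<delta> "- \<gamma>"]) simp_all
    next
      case 3
      then show ?thesis by (intro that[of 1 0]) simp_all
    qed
  qed
  note h = algebra_homD[OF subst3_hom(1)[OF const_hom_id]] subst3_hom(2-4)[OF const_hom_id]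
  have "subst3 id u v 0 F = subst3 id 0 0 0 F" for F
  proof (rule algebra_hom_eqI[OF subst3_hom(1)[OF const_hom_id] subst3_hom(1)[OF const_hom_id]])
    show "F \<in> adjoin const3 (set
        [const3 \<alpha> * varX + const3 \<beta> * varY, const3 \<gamma> * varX + const3 \<delta> * varY, varZ])"
      using assms by (simp only: coordinate_system_def UNIV_I)
    fix t assume "t \<in> set
        [const3 \<alpha> * varX + const3 \<beta> * varY, const3 \<gamma> * varX + const3 \<delta> * varY, varZ]"
    then show "subst3 id u v 0 t = subst3 id 0 0 0 t" using uv(2,3) by (auto simp: h)
  qed
  from this[of varX] this[of varY] show False using uv(1) by (simp add: h)
qed

text \<open>
  Clear denominators and divide by the greatest common divisor.  The coefficients \<open>u, v\<close>
  complete \<open>(a, b)\<close> to a matrix of determinant \<open>1\<close> over \<open>R\<close>.\<close>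

lemma PID_primitive_proportional_pair:
  fixes \<alpha> \<beta> :: "'a::idom fract"
  assumes "is_PID TYPE('a)" "\<alpha> \<noteq> 0 \<or> \<beta> \<noteq> 0"
  obtains k a b u v where "\<alpha> = k * to_fract a" "\<beta> = k * to_fract b" "u * a + v * b = 1"
proof -
  obtain a0 s where a0: "\<alpha> = Fract a0 s" "s \<noteq> 0" by (cases \<alpha>) auto
  obtain b0 t where b0: "\<beta> = Fract b0 t" "t \<noteq> 0" by (cases \<beta>) auto
  obtain d u v where d: "d dvd a0 * t" "d dvd b0 * s" "d = u * (a0 * t) + v * (b0 * s)"
    by (rule PID_bezout[OF assms(1)])
  obtain a b where ab: "a0 * t = d * a" "b0 * s = d * b" using d(1,2) by (auto elim!: dvdE)
  have "d \<noteq> 0"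
  proof
    assume "d = 0"
    then have "a0 = 0" "b0 = 0" using ab a0 b0 by auto
    then show False using assms(2) a0 b0 by (simp add: Fract_conv_to_fract)
  qed
  define k where "k = to_fract d / to_fract (s * t)"
  have "\<alpha> = to_fract (a0 * t) / to_fract (s * t)" "\<beta> = to_fract (b0 * s) / to_fract (s * t)"
    using a0 b0 by (simp_all add: Fract_conv_to_fract)
  then have "\<alpha> = k * to_fract a" "\<beta> = k * to_fract b"
    unfolding ab k_def by simp_all
  moreover have "d * (u * a + v * b) = d * 1"
    using d(3) unfolding ab by (simp add: algebra_simps)
  then have "u * a + v * b = 1" using \<open>d \<noteq> 0\<close> mult_left_cancel by blast
  ultimately show ?thesis using that by blast
qed

section \<open>The structure theorem\<close>

theorem proposition4p4:
  fixes D :: "'a::idom poly3 \<Rightarrow> 'a poly3"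
    and D' :: "'a fract poly3 \<Rightarrow> 'a fract poly3"
    and L1' L2' :: "'a fract poly3"
  assumes "is_PID TYPE('a)"
    and "contains_rationals TYPE('a)"
    and "derivation const3 D"
    and "locally_nilpotent D"
    and "\<not> reducible_der D"
    and "D (D varX) = 0"
    and "D (D varY) = 0"
    and "derivation const3 D'"
    and "locally_nilpotent D'"
    and "\<And>b. D' (to_fract3 b) = to_fract3 (D b)"
    and "linear_form_XY L1'"
    and "linear_form_XY L2'"
    and "coordinate_system const3 3 [L1', L2', varZ]"
    and "D' L1' = 0"
    and "D' L2' \<in> adjoin const3 {L1'}"
    and "D' varZ \<in> adjoin const3 {L1', L2'}"
  shows "der_rank const3 3 D < 3 \<and>
    (\<exists>L1 L2. linear_form_XY L1 \<and> linear_form_XY L2 \<and>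
       coordinate_system const3 3 [L1, L2, varZ] \<and>
       D L1 = 0 \<and>
       D L2 \<in> adjoin const3 {L1} \<and>
       D varZ \<in> adjoin const3 {L1, L2} \<and>
       adjoin const3 {L1, L2} = adjoin const3 {varX, varY} \<and>
       (\<exists>b f. b \<in> adjoin const3 {L1} \<and>
          (\<forall>i. coeff f i \<in> adjoin const3 {L1}) \<and>
          poly f L2 \<in> adjoin const3 {L1, L2} \<and>
          kernel D = adjoin const3 {L1, b * varZ + poly f L2}))"
proof -
  note der = derivationD[OF assms(3)] and der' = derivationD[OF assms(8)]
  note fr = algebra_homD[OF to_fract3_hom(1)] to_fract3_hom(2-4)
  obtain \<alpha> \<beta> \<gamma> \<delta> where L1': "L1' = const3 \<alpha> * varX + const3 \<beta> * varY"
    and L2': "L2' = const3 \<gamma> * varX + const3 \<delta> * varY"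
    using assms(11,12) unfolding linear_form_XY_def by blast
  have det: "\<alpha> * \<delta> - \<beta> * \<gamma> \<noteq> 0"
    using coordinate_linear_forms_det assms(13) unfolding L1' L2' by blast
  then obtain k a b d c' where k: "\<alpha> = k * to_fract a" "\<beta> = k * to_fract b" and "d * a + c' * b = 1"
    using PID_primitive_proportional_pair[OF assms(1), of \<alpha> \<beta>] by (metis diff_zero mult_zero_left)
  \<comment> \<open>The sign turns Bezout's identity into determinant \<open>1\<close> for the rows \<open>(a, b)\<close> and \<open>(c, d)\<close>.\<close>
  define c where "c = - c'"
  have det1: "a * d - b * c = 1" using \<open>d * a + c' * b = 1\<close> by (simp add: c_def algebra_simps)
  have "k \<noteq> 0" using det k by auto
  define L1 L2 where "L1 = const3 a * varX + const3 b * varY" and "L2 = const3 c * varX + const3 d * varY"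
  define \<sigma> \<tau> where "\<sigma> = linear_subst a b c d" and "\<tau> = linear_subst d (- b) (- c) a"
  define \<tau>' where "\<tau>' = linear_subst (to_fract d) (to_fract (- b)) (to_fract (- c)) (to_fract a)"
  have \<tau>\<sigma>: "\<tau> (\<sigma> F) = F" for F
    unfolding \<sigma>_def \<tau>_def by (rule linear_subst_inverse[OF det1])
  have \<sigma>\<tau>: "\<sigma> (\<tau> F) = F" for F
    unfolding \<sigma>_def \<tau>_def using linear_subst_inverse[of d a "- b" "- c" F] det1 by (simp add: mult.commute)
  have \<tau>': "to_fract3 (\<tau> F) = \<tau>' (to_fract3 F)" for F
    unfolding \<tau>_def \<tau>'_def by (rule to_fract3_linear_subst)
  have \<sigma>_hom: "algebra_hom const3 const3 \<sigma>" and \<tau>_hom: "algebra_hom const3 const3 \<tau>"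
    and \<tau>'_hom: "algebra_hom const3 const3 \<tau>'"
    unfolding \<sigma>_def \<tau>_def \<tau>'_def by (rule linear_subst_hom)+
  have \<sigma>_vars: "\<sigma> varX = L1" "\<sigma> varY = L2" "\<sigma> varZ = varZ"
    unfolding \<sigma>_def L1_def L2_def by (rule linear_subst_vars)+
  then have \<tau>_forms: "\<tau> L1 = varX" "\<tau> L2 = varY" "\<tau> varZ = varZ" by (metis \<tau>\<sigma>)+
  note \<sigma> = algebra_homD[OF \<sigma>_hom] and \<tau> = algebra_homD[OF \<tau>_hom]
  have forms: "linear_form_XY L1" "linear_form_XY L2"
    unfolding L1_def L2_def linear_form_XY_def by blast+
  have gen: "adjoin const3 {L1} = \<sigma> ` adjoin const3 {varX}"
    "adjoin const3 {L1, L2} = \<sigma> ` adjoin const3 {varX, varY}"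
    "adjoin const3 {L1, L2, varZ} = UNIV"
    using adjoin_image[OF \<sigma>_hom, of "{varX}"] adjoin_image[OF \<sigma>_hom, of "{varX, varY}"]
      adjoin_image[OF \<sigma>_hom, of "{varX, varY, varZ}"] surjI[of \<sigma> \<tau>, OF \<sigma>\<tau>]
    by (simp_all add: \<sigma>_vars adjoin_XYZ)
  have XY: "adjoin const3 {L1, L2} = adjoin const3 {varX, varY}"
  proof
    show "adjoin const3 {L1, L2} \<subseteq> adjoin const3 {varX, varY}"
      unfolding gen \<sigma>_def by (rule linear_subst_adjoin_XY)
    have "\<sigma> ` \<tau> ` adjoin const3 {varX, varY} \<subseteq> \<sigma> ` adjoin const3 {varX, varY}"
      unfolding \<tau>_def by (intro image_mono linear_subst_adjoin_XY)
    then show "adjoin const3 {varX, varY} \<subseteq> adjoin const3 {L1, L2}"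
      unfolding gen by (simp add: image_image \<sigma>\<tau>)
  qed

  have L1'_multiple: "L1' = const3 k * to_fract3 L1"
    by (simp add: L1' L1_def fr k const3_simps algebra_simps)
  have "const3 k * to_fract3 (D L1) = 0"
  proof -
    have "const3 k * D' (to_fract3 L1) = D' L1'"
      unfolding L1'_multiple by (simp add: der')
    then show ?thesis using assms(10,14) by simp
  qed
  then have "to_fract3 (D L1) = to_fract3 0"
    using \<open>k \<noteq> 0\<close> by (simp add: fr const3_def)
  then have DL1: "D L1 = 0" using inj_to_fract3 by (auto dest: injD)

  \<comment> \<open>Express \<open>L2\<close> in \<open>L1'\<close> and \<open>L2'\<close> over \<open>K\<close>; the coefficients come from Cramer's rule.\<close>
  define \<Delta> where "\<Delta> = \<alpha> * \<delta> - \<beta> * \<gamma>"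
  define \<mu> \<nu> where "\<mu> = (to_fract c * \<delta> - to_fract d * \<gamma>) / \<Delta>"
    and "\<nu> = (to_fract d * \<alpha> - to_fract c * \<beta>) / \<Delta>"
  have cramer: "to_fract c = \<mu> * \<alpha> + \<nu> * \<gamma>" "to_fract d = \<mu> * \<beta> + \<nu> * \<delta>"
    using det unfolding \<mu>_def \<nu>_def \<Delta>_def[symmetric]
    by (simp_all add: field_simps) (simp_all add: \<Delta>_def algebra_simps)
  have "to_fract3 L2 = const3 \<mu> * L1' + const3 \<nu> * L2'"
    by (simp add: L2_def fr cramer L1' L2' const3_simps algebra_simps)
  then have "to_fract3 (D L2) = const3 \<nu> * D' L2'"
    using assms(10)[of L2] by (simp add: der' assms(14))
  then have "to_fract3 (D L2) \<in> adjoin const3 {L1'}"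
    using assms(15) by (simp add: adjoin_mult adjoin_const)
  then have "to_fract3 (\<tau> (D L2)) \<in> \<tau>' ` adjoin const3 {L1'}" unfolding \<tau>' by blast
  also have "\<dots> = adjoin const3 {\<tau>' L1'}" using adjoin_image[OF \<tau>'_hom, of "{L1'}"] by simp
  also have "\<tau>' L1' = const3 k * varX"
    unfolding L1'_multiple by (simp add: algebra_homD[OF \<tau>'_hom] flip: \<tau>') (simp add: \<tau>_forms fr)
  also have "adjoin const3 {const3 k * varX} \<subseteq> adjoin const3 {varX}"
    by (rule adjoin_least[OF _ subalgebra_adjoin]) (auto intro: adjoin_intros adjoin_gen)
  finally obtain p where p: "\<tau> (D L2) = [:[:p:]:]" by (rule to_fract3_adjoin_X_descends)

  have "adjoin const3 {L1', L2'} \<subseteq> adjoin const3 {varX, varY}"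
    by (rule adjoin_least[OF _ subalgebra_adjoin]) (use assms(11,12) linear_form_in_adjoin in auto)
  then have "to_fract3 (\<tau> (D varZ)) \<in> \<tau>' ` adjoin const3 {varX, varY}"
    using assms(16) assms(10)[of varZ] unfolding \<tau>' by (auto simp: fr)
  also have "\<dots> \<subseteq> adjoin const3 {varX, varY}" unfolding \<tau>'_def by (rule linear_subst_adjoin_XY)
  finally obtain q where q: "\<tau> (D varZ) = [:q:]" by (rule to_fract3_adjoin_XY_descends)

  \<comment> \<open>In the coordinates \<open>(L1, L2, Z)\<close> the derivation becomes the triangular \<open>D1\<close>.\<close>
  define D1 where "D1 F = \<tau> (D (\<sigma> F))" for F
  have D_D1: "D F = \<sigma> (D1 (\<tau> F))" for F by (simp add: D1_def \<sigma>\<tau>)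
  interpret triangular_derivation D1 p q
  proof
    show "derivation const3 D1" by (simp add: derivation_def D1_def \<sigma> \<tau> der \<tau>\<sigma>)
    show "D1 varX = 0" "D1 varY = [:[:p:]:]" "D1 varZ = [:q:]"
      by (simp_all add: D1_def \<sigma>_vars DL1 p q \<tau>)
  qed
  have "\<not> reducible_der D1"
  proof
    assume "reducible_der D1"
    then obtain e where e: "\<not> e dvd 1" "\<And>F. e dvd D1 F"
      unfolding reducible_der_def dvd_def by blast
    have hom_dvd: "\<phi> x dvd \<phi> y" if "algebra_hom const3 const3 \<phi>" "x dvd y"
      for \<phi> :: "'a poly3 \<Rightarrow> 'a poly3" and x y
      using that algebra_homD(2)[OF that(1)] by (metis dvd_def)
    have "\<sigma> e dvd D F" for F unfolding D_D1 by (rule hom_dvd[OF \<sigma>_hom e(2)])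
    then have "range D \<subseteq> {\<sigma> e * x | x. True}" by (auto simp: dvd_def)
    then have "\<sigma> e dvd 1" using assms(5) unfolding reducible_der_def by blast
    then have "\<tau> (\<sigma> e) dvd \<tau> 1" by (rule hom_dvd[OF \<tau>_hom])
    moreover have "\<tau> 1 = 1" using \<tau>(3)[of 1] by (simp add: const3_simps)
    ultimately show False using e(1) by (simp add: \<tau>\<sigma>)
  qed
  then obtain g P where ker: "kernel D1 = adjoin const3 {varX, [:[:g:]:] * varZ + [:P:]}"
    using irreducible_kernel assms(1,2) by blast
  define f where "f = map_poly (\<lambda>h. \<sigma> [:[:h:]:]) P"
  have f: "\<sigma> [:P:] = poly f L2"
    unfolding f_def \<sigma>_vars(2)[symmetric] unfolding \<sigma>_def by (rule linear_subst_poly)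
  have "kernel D = \<sigma> ` kernel D1"
  proof (intro equalityI subsetI)
    fix F assume "F \<in> kernel D"
    then have "\<tau> F \<in> kernel D1" by (simp add: kernel_def D1_def \<sigma>\<tau> \<tau>(4))
    then show "F \<in> \<sigma> ` kernel D1" by (metis \<sigma>\<tau> imageI)
  next
    fix F assume "F \<in> \<sigma> ` kernel D1"
    then show "F \<in> kernel D" by (auto simp: kernel_def D_D1 \<tau>\<sigma> \<sigma>(4))
  qed
  also have "\<dots> = adjoin const3 {L1, \<sigma> [:[:g:]:] * varZ + poly f L2}"
    unfolding ker adjoin_image[OF \<sigma>_hom] by (simp add: \<sigma> \<sigma>_vars f del: mult_pCons_left)
  finally have kernel: "kernel D = adjoin const3 {L1, \<sigma> [:[:g:]:] * varZ + poly f L2}" .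

  have "adjoin const3 {L1} \<subseteq> kernel D"
    by (rule adjoin_least[OF _ kernel_subalgebra[OF assms(3)]]) (simp add: kernel_def DL1)
  moreover have "coordinate_system const3 3 [L2, varZ, L1]"
    using gen(3) by (simp add: coordinate_system_def insert_commute)
  ultimately have "der_rank const3 3 D \<le> 2"
    unfolding der_rank_def by (intro Least_le conjI exI[of _ "[L2, varZ, L1]"]) simp_all
  then have rank: "der_rank const3 3 D < 3" by simp
  have in1: "\<sigma> [:[:h:]:] \<in> adjoin const3 {L1}" for h unfolding gen adjoin_X by blast
  have in2: "\<sigma> [:h:] \<in> adjoin const3 {L1, L2}" for h unfolding gen adjoin_XY by blast
  have "D L2 = \<sigma> [:[:p:]:]" "D varZ = \<sigma> [:q:]" by (simp_all add: \<sigma>\<tau> flip: p q)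
  moreover have "coeff f i \<in> adjoin const3 {L1}" for i
    unfolding f_def using in1 by (simp add: coeff_map_poly \<sigma>)
  moreover have "coordinate_system const3 3 [L1, L2, varZ]"
    using gen(3) by (simp add: coordinate_system_def)
  ultimately show ?thesis
    using rank forms DL1 in1 in2 XY kernel f by metis
qed

end
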